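(* Let $G$ be an undirected loopless quantum graph and $X\sqsubseteq V(G)$ a projective subset. Then $X$ is a vertex cover of $G$, i.e. $E(G)\sqsubseteq(X\times V(G))\cup(V(G)\times X)\cup(X\times X)$, if and only if its complement $X^c$ is an independent set of $G$, i.e. $X^c\times X^c$ and $E(G)$ are disjoint.
   Context: All Hilbert spaces are finite-dimensional; "projector" means orthogonal projector. Quantum sets. A quantum set is a special symmetric $\dagger$-Frobenius monoid in finite-dimensional Hilbert spaces; equivalently a finite-dimensional C*-algebra, up to isomorphism $X=\bigoplus_{i=1}^k M_{n_i}$ with the usual product, unit $1$ and involution, and inner product $\langle a,b\rangle=\sum_i n_i\mathrm{Tr}(a_i^*b_i)$, for which the multiplication $m:X\otimes X\to X$ satisfies $mm^\dagger=\mathrm{id}_X$. It acts block-diagonally on $H=\bigoplus_i\mathbb{C}^{n_i}$, so $X\subseteq B(H)$. Projective subsets. A projective subset $Y\sqsubseteq X$ is given by a projector $\widehat Y:X\to X$ with $\widehat Y(ab)=\widehat Y(a)b$ for all $a,b\in X$. These correspond bijectively to projections $\widetilde Y=\widehat Y(1)\in X$, via $\widehat Y(a)=\widetilde Ya$; $\widetilde Y$ is also viewed as a projector on $H$. The quantum set $X$ itself is the projective subset with projection $1$. For $Y,Z\sqsubseteq X$: the complement $Y^c$ has projection $1-\widetilde Y$; the union $Y\cup Z$ has as its projection the projector onto $\mathrm{span}(\mathrm{img}\,\widetilde Y\cup\mathrm{img}\,\widetilde Z)$; $Y\sqsubseteq Z$ means $\mathrm{img}\,\widetilde Y\subseteq\mathrm{img}\,\widetilde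 Z$; $Y,Z$ are disjoint if $\mathrm{img}\,\widetilde Y\perp\mathrm{img}\,\widetilde Z$. Cartesian products. For $V\subseteq B(H)$, the quantum set $V^{op}\otimes V$ acts on $H^*\otimes H\cong B(H)$ (identify $\langle u|\otimes|v\rangle$ with $|v\rangle\langle u|$) by $(a\otimes b)\cdot x=bxa$; thus projections in $V^{op}\otimes V$ have images in $B(H)$, which carries the Hilbert–Schmidt inner product. For $Y,Z\sqsubseteq V$, $Y\times Z\sqsubseteq V^{op}\otimes V$ is the projective subset whose projection acts on $B(H)$ as $x\mapsto\widetilde Zx\widetilde Y$ (i.e. as $\overline{\widetilde Y}\otimes\widetilde Z$ on $H^*\otimes H$). Quantum graphs. A quantum graph $G$ is a quantum set $V=V(G)$ with an adjacency operator $A_G:V\to V$ satisfying $m(A_G\otimes A_G)m^\dagger=A_G$ and $A_G(x^* )=A_G(x)^*$. Equivalently, it is given by its edge relation $E(G)\sqsubseteq V^{op}\otimes V$, i.e. a projector $\widehat{E(G)}$ on $V\otimes V$ with $\widehat{E(G)}(ax\otimes yb)=(a\otimes 1)\widehat{E(G)}(x\otimes y)(1\otimes b)$, related by $\widehat{E(G)}=(\mathrm{id}\otimes m)(\mathrm{id}\otimes A_G\otimes\mathrm{id})(m^\dagger\otimes\mathrm{id})$. $G$ is undirected if $A_G=A_G^\dagger$ and loopless if $m(A_G\otimes\mathrm{id})m^\dagger=0$. *)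

theory Defs
  imports "HOL-Analysis.Analysis"
begin

text \<open>
  Quantum sets are taken in their concrete form: the direct sum of full matrix algebras
  acting block-diagonally on a Hilbert space \<open>H\<close>.  The standard basis of \<open>H\<close> is a subset of a
  finite type \<open>'n\<close>, and the blocks are the classes of an equivalence relation \<open>V\<close> on that
  subset.  So \<open>Field V\<close> indexes the basis of \<open>H\<close>, \<open>Field V // V\<close> is the set of blocks, the
  numbers \<open>n\<^sub>i\<close> are the cardinalities of the blocks, and all matrices are zero outside
  \<open>Field V\<close>.  (Using a subset of \<open>'n\<close> instead of all of \<open>'n\<close> admits the zero algebra.)
\<close>

type_synonym 'n cmat = "complex ^ 'n ^ 'n"

definition cscale :: "complex \<Rightarrow> 'n::finite cmat \<Rightarrow> 'n cmat" where
  "cscale c a = (\<chi> i j. c * a $ i $ j)"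

interpretation cmat: vector_space cscale
  by unfold_locales (simp_all add: cscale_def vec_eq_iff algebra_simps)

definition cadj :: "'n::finite cmat \<Rightarrow> 'n cmat" where
  "cadj a = (\<chi> i j. cnj (a $ j $ i))"

definition munit :: "'n::finite \<Rightarrow> 'n \<Rightarrow> 'n cmat" where
  "munit i j = (\<chi> r s. if r = i \<and> s = j then 1 else 0)"


section \<open>Quantum sets\<close>

definition quantum_set :: "('n::finite \<times> 'n) set \<Rightarrow> bool" where
  "quantum_set V \<longleftrightarrow> equiv (Field V) V"

definition qalg :: "('n::finite \<times> 'n) set \<Rightarrow> 'n cmat set" where
  "qalg V = {a. \<forall>i j. a $ i $ j \<noteq> 0 \<longrightarrow> (i, j) \<in> V}"

definition qone :: "('n::finite \<times> 'n) set \<Rightarrow> 'n cmat" where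
  "qone V = (\<chi> i j. if i = j \<and> i \<in> Field V then 1 else 0)"

definition qinner :: "('n::finite \<times> 'n) set \<Rightarrow> 'n cmat \<Rightarrow> 'n cmat \<Rightarrow> complex" where
  "qinner V a b = (\<Sum>B\<in>Field V // V. of_nat (card B) * (\<Sum>i\<in>B. (cadj a ** b) $ i $ i))"

definition qlinear ::
  "('n::finite \<times> 'n) set \<Rightarrow> ('m::finite \<times> 'm) set \<Rightarrow> ('n cmat \<Rightarrow> 'm cmat) \<Rightarrow> bool" where
  "qlinear V W f \<longleftrightarrow>
     (\<forall>a\<in>qalg V. f a \<in> qalg W) \<and>
     (\<forall>a\<in>qalg V. \<forall>b\<in>qalg V. f (a + b) = f a + f b) \<and>
     (\<forall>c. \<forall>a\<in>qalg V. f (cscale c a) = cscale c (f a))"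

definition qadjoint ::
  "('n::finite \<times> 'n) set \<Rightarrow> ('m::finite \<times> 'm) set \<Rightarrow> ('n cmat \<Rightarrow> 'm cmat) \<Rightarrow> 'm cmat \<Rightarrow> 'n cmat" where
  "qadjoint V W f b = (THE a. a \<in> qalg V \<and> (\<forall>x\<in>qalg V. qinner V x a = qinner W (f x) b))"


section \<open>Tensor products\<close>

text \<open>
  The tensor product of two quantum sets is again one, with basis the pairs of basis indices
  and blocks the products of blocks; its elements are matrices indexed by pairs.
\<close>

definition qtensor ::
  "('n::finite \<times> 'n) set \<Rightarrow> ('m::finite \<times> 'm) set \<Rightarrow> (('n \<times> 'm) \<times> ('n \<times> 'm)) set" where
  "qtensor V W = {((i, k), (j, l)) | i k j l. (i, j) \<in> V \<and> (k, l) \<in> W}"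

definition tensor :: "'n::finite cmat \<Rightarrow> 'm::finite cmat \<Rightarrow> ('n \<times> 'm) cmat" where
  "tensor a b = (\<chi> p q. a $ fst p $ fst q * b $ snd p $ snd q)"

text \<open>The tensor product of linear maps, by expansion in matrix units.\<close>

definition tensor_map ::
  "('n::finite cmat \<Rightarrow> 'p::finite cmat) \<Rightarrow> ('m::finite cmat \<Rightarrow> 'q::finite cmat) \<Rightarrow>
     ('n \<times> 'm) cmat \<Rightarrow> ('p \<times> 'q) cmat" where
  "tensor_map f g t =
     (\<Sum>i\<in>UNIV. \<Sum>j\<in>UNIV. \<Sum>k\<in>UNIV. \<Sum>l\<in>UNIV.
        cscale (t $ (i, k) $ (j, l)) (tensor (f (munit i j)) (g (munit k l))))"

definition tensor_assoc ::
  "(('n::finite \<times> 'm::finite) \<times> 'p::finite) cmat \<Rightarrow> ('n \<times> 'm \<times> 'p) cmat" where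
  "tensor_assoc t =
     (\<chi> p q. t $ ((fst p, fst (snd p)), snd (snd p)) $ ((fst q, fst (snd q)), snd (snd q)))"

definition mult :: "('n::finite \<times> 'n) cmat \<Rightarrow> 'n cmat" where
  "mult t = (\<chi> i j. \<Sum>k\<in>UNIV. t $ (i, k) $ (k, j))"

lemma mult_tensor: "mult (tensor a b) = a ** b"
  by (simp add: mult_def tensor_def matrix_matrix_mult_def)

definition comult :: "('n::finite \<times> 'n) set \<Rightarrow> 'n cmat \<Rightarrow> ('n \<times> 'n) cmat" where
  "comult V = qadjoint (qtensor V V) V mult"

text \<open>
  The action of \<open>V\<^sup>o\<^sup>p \<otimes> V\<close> on \<open>B(H)\<close>, the linear extension of \<open>(a \<otimes> b) \<cdot> x = b x a\<close>.
  The underlying vector space of \<open>V\<^sup>o\<^sup>p \<otimes> V\<close> is that of \<open>V \<otimes> V\<close>.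
\<close>

definition op_act :: "('n::finite \<times> 'n) cmat \<Rightarrow> 'n cmat \<Rightarrow> 'n cmat" where
  "op_act t x = (\<chi> k j. \<Sum>i\<in>UNIV. \<Sum>l\<in>UNIV. t $ (i, k) $ (j, l) * x $ l $ i)"

lemma op_act_tensor: "op_act (tensor a b) x = b ** x ** a"
  by (simp add: op_act_def tensor_def matrix_matrix_mult_def vec_eq_iff
      sum_distrib_left sum_distrib_right mult_ac)


section \<open>Projective subsets\<close>

definition projective_subset :: "('n::finite \<times> 'n) set \<Rightarrow> ('n cmat \<Rightarrow> 'n cmat) \<Rightarrow> bool" where
  "projective_subset V Y \<longleftrightarrow>
     qlinear V V Y \<and>
     (\<forall>a\<in>qalg V. Y (Y a) = Y a) \<and>
     (\<forall>a\<in>qalg V. \<forall>b\<in>qalg V. qinner V (Y a) b = qinner V a (Y b)) \<and>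
     (\<forall>a\<in>qalg V. \<forall>b\<in>qalg V. Y (a ** b) = Y a ** b)"

definition projection :: "('n::finite \<times> 'n) set \<Rightarrow> ('n cmat \<Rightarrow> 'n cmat) \<Rightarrow> 'n cmat" where
  "projection V Y = Y (qone V)"

definition whole :: "'n::finite cmat \<Rightarrow> 'n cmat" where
  "whole a = a"

definition complement ::
  "('n::finite \<times> 'n) set \<Rightarrow> ('n cmat \<Rightarrow> 'n cmat) \<Rightarrow> 'n cmat \<Rightarrow> 'n cmat" where
  "complement V Y a = (qone V - projection V Y) ** a"


section \<open>Projective subsets of \<open>V\<^sup>o\<^sup>p \<otimes> V\<close>\<close>

text \<open>These are represented by the action of their projections on \<open>B(H)\<close>.\<close>

definition BH :: "('n::finite \<times> 'n) set \<Rightarrow> 'n cmat set" where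
  "BH V = {x. \<forall>i j. x $ i $ j \<noteq> 0 \<longrightarrow> i \<in> Field V \<and> j \<in> Field V}"

definition hs_inner :: "'n::finite cmat \<Rightarrow> 'n cmat \<Rightarrow> complex" where
  "hs_inner x y = trace (cadj x ** y)"

definition img :: "('n::finite \<times> 'n) set \<Rightarrow> ('n cmat \<Rightarrow> 'n cmat) \<Rightarrow> 'n cmat set" where
  "img V P = P ` BH V"

definition projector_onto :: "'n::finite cmat set \<Rightarrow> 'n cmat \<Rightarrow> 'n cmat" where
  "projector_onto S x = (THE y. y \<in> S \<and> (\<forall>z\<in>S. hs_inner z (x - y) = 0))"

definition psub ::
  "('n::finite \<times> 'n) set \<Rightarrow> ('n cmat \<Rightarrow> 'n cmat) \<Rightarrow> ('n cmat \<Rightarrow> 'n cmat) \<Rightarrow> bool" where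
  "psub V P Q \<longleftrightarrow> img V P \<subseteq> img V Q"

definition pdisjoint ::
  "('n::finite \<times> 'n) set \<Rightarrow> ('n cmat \<Rightarrow> 'n cmat) \<Rightarrow> ('n cmat \<Rightarrow> 'n cmat) \<Rightarrow> bool" where
  "pdisjoint V P Q \<longleftrightarrow> (\<forall>x\<in>img V P. \<forall>y\<in>img V Q. hs_inner x y = 0)"

definition punion ::
  "('n::finite \<times> 'n) set \<Rightarrow> ('n cmat \<Rightarrow> 'n cmat) \<Rightarrow> ('n cmat \<Rightarrow> 'n cmat) \<Rightarrow> 'n cmat \<Rightarrow> 'n cmat" where
  "punion V P Q = projector_onto (cmat.span (img V P \<union> img V Q))"

definition pcross ::
  "('n::finite \<times> 'n) set \<Rightarrow> ('n cmat \<Rightarrow> 'n cmat) \<Rightarrow> ('n cmat \<Rightarrow> 'n cmat) \<Rightarrow> 'n cmat \<Rightarrow> 'n cmat" where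
  "pcross V Y Z x = projection V Z ** x ** projection V Y"


section \<open>Quantum graphs\<close>

definition quantum_graph :: "('n::finite \<times> 'n) set \<Rightarrow> ('n cmat \<Rightarrow> 'n cmat) \<Rightarrow> bool" where
  "quantum_graph V A \<longleftrightarrow>
     quantum_set V \<and> qlinear V V A \<and>
     (\<forall>x\<in>qalg V. mult (tensor_map A A (comult V x)) = A x) \<and>
     (\<forall>x\<in>qalg V. A (cadj x) = cadj (A x))"

definition undirected :: "('n::finite \<times> 'n) set \<Rightarrow> ('n cmat \<Rightarrow> 'n cmat) \<Rightarrow> bool" where
  "undirected V A \<longleftrightarrow> (\<forall>x\<in>qalg V. A x = qadjoint V V A x)"

definition loopless :: "('n::finite \<times> 'n) set \<Rightarrow> ('n cmat \<Rightarrow> 'n cmat) \<Rightarrow> bool" where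
  "loopless V A \<longleftrightarrow> (\<forall>x\<in>qalg V. mult (tensor_map A id (comult V x)) = 0)"

text \<open>The operator \<open>(id \<otimes> m)(id \<otimes> A \<otimes> id)(m\<^sup>\<dagger> \<otimes> id)\<close> on \<open>V \<otimes> V\<close>.\<close>

definition edge_op ::
  "('n::finite \<times> 'n) set \<Rightarrow> ('n cmat \<Rightarrow> 'n cmat) \<Rightarrow> ('n \<times> 'n) cmat \<Rightarrow> ('n \<times> 'n) cmat" where
  "edge_op V A t =
     tensor_map id mult
       (tensor_assoc (tensor_map (tensor_map id A) id (tensor_map (comult V) id t)))"

definition edges :: "('n::finite \<times> 'n) set \<Rightarrow> ('n cmat \<Rightarrow> 'n cmat) \<Rightarrow> 'n cmat \<Rightarrow> 'n cmat" where
  "edges V A = op_act (edge_op V A (tensor (qone V) (qone V)))"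

definition vertex_cover ::
  "('n::finite \<times> 'n) set \<Rightarrow> ('n cmat \<Rightarrow> 'n cmat) \<Rightarrow> ('n cmat \<Rightarrow> 'n cmat) \<Rightarrow> bool" where
  "vertex_cover V A X \<longleftrightarrow>
     psub V (edges V A)
       (punion V (punion V (pcross V X whole) (pcross V whole X)) (pcross V X X))"

definition independent_set ::
  "('n::finite \<times> 'n) set \<Rightarrow> ('n cmat \<Rightarrow> 'n cmat) \<Rightarrow> ('n cmat \<Rightarrow> 'n cmat) \<Rightarrow> bool" where
  "independent_set V A X \<longleftrightarrow> pdisjoint V (pcross V X X) (edges V A)"

end

theory Submission
  imports Defs
begin

text \<open>
  Let \<open>p\<close> be the projection of \<open>X\<close> and \<open>q = 1 - p\<close> that of its complement.  The three products
  that make up the cover condition have the images \<open>B(H) p\<close>, \<open>p B(H)\<close> and \<open>p B(H) p\<close>.  Cutting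
  \<open>x\<close> into the four corners \<open>pxp\<close>, \<open>pxq\<close>, \<open>qxp\<close>, \<open>qxq\<close> shows that they span exactly the operators
  \<open>x\<close> whose last corner \<open>qxq\<close> vanishes.  So \<open>X\<close> is a vertex cover iff \<open>qeq = 0\<close> for every \<open>e\<close> in
  the image of the edge relation.  The image of the product of the complement with itself is
  \<open>q B(H) q\<close>, and since \<open>q\<close> is self-adjoint, \<open>\<langle>qxq, e\<rangle> = \<langle>x, qeq\<rangle>\<close> (lemma \<open>hs_inner_compress\<close>);
  hence \<open>e\<close> is orthogonal to this image iff \<open>qeq\<close> is orthogonal to all of \<open>B(H)\<close>, that is, iff
  \<open>qeq = 0\<close>.

  Three facts support this argument.  The projection of a projective subset is a self-adjoint
  idempotent (lemma \<open>projection_is_projector\<close>), because the weighted trace inner product on the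
  algebra is definite.  The projector onto a span, which defines the union, has that span as its
  image (lemma \<open>img_projector_onto\<close>), as soon as orthogonal decompositions exist; here
  \<open>x = (x - qxq) + qxq\<close> is one.  Finally, the edge relation maps into \<open>B(H)\<close> (lemma
  \<open>edges_in_BH\<close>).  For this, every map in its definition must preserve the block structure, and
  for the comultiplication, given as an adjoint by description, that amounts to the existence
  and uniqueness of adjoints (lemma \<open>qadjoint_in_qalg\<close>).
\<close>

section \<open>Matrix algebra\<close>

lemma mult_diff_right: "a ** (b - c) = a ** b - a ** (c :: 'n::finite cmat)"
  by (simp add: matrix_matrix_mult_def vec_eq_iff right_diff_distrib sum_subtractf)

lemma mult_diff_left: "(a - b) ** c = a ** c - b ** (c :: 'n::finite cmat)"
  by (simp add: matrix_matrix_mult_def vec_eq_iff left_diff_distrib sum_subtractf)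

lemma mult_add_left: "(a + b) ** c = a ** c + b ** (c :: 'n::finite cmat)"
  by (simp add: matrix_matrix_mult_def vec_eq_iff distrib_right sum.distrib)

lemma mult_cscale_left: "cscale k a ** b = cscale k (a ** b)"
  by (simp add: matrix_matrix_mult_def cscale_def vec_eq_iff sum_distrib_left mult_ac)

lemma mult_cscale_right: "a ** cscale k b = cscale k (a ** b)"
  by (simp add: matrix_matrix_mult_def cscale_def vec_eq_iff sum_distrib_left mult_ac)

lemma cadj_mult: "cadj (a ** b) = cadj b ** cadj a"
  by (simp add: matrix_matrix_mult_def cadj_def vec_eq_iff mult.commute)

lemma cadj_cadj: "cadj (cadj a) = a"
  by (simp add: cadj_def vec_eq_iff)

lemma matrix_unit_expansion:
  assumes "a \<in> qalg V"
  shows "a = (\<Sum>p\<in>V. cscale (a $ fst p $ snd p) (munit (fst p) (snd p)))"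
proof -
  have "(\<Sum>p\<in>V. cscale (a $ fst p $ snd p) (munit (fst p) (snd p))) $ i $ j = a $ i $ j" for i j
  proof -
    have "(\<Sum>p\<in>V. cscale (a $ fst p $ snd p) (munit (fst p) (snd p))) $ i $ j
        = (\<Sum>p\<in>V. if p = (i, j) then a $ i $ j else 0)"
      unfolding sum_component
      by (intro sum.cong) (auto simp: cscale_def munit_def)
    also have "\<dots> = a $ i $ j"
      using assms by (auto simp: qalg_def)
    finally show ?thesis .
  qed
  then show ?thesis
    by (simp add: vec_eq_iff)
qed

lemma munit_in_qalg: "(i, j) \<in> V \<Longrightarrow> munit i j \<in> qalg V"
  by (auto simp: munit_def qalg_def)

lemma qalg_closed:
  shows zero_in_qalg: "0 \<in> qalg V"
    and add_in_qalg: "a \<in> qalg V \<Longrightarrow> b \<in> qalg V \<Longrightarrow> a + b \<in> qalg V"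
    and diff_in_qalg: "a \<in> qalg V \<Longrightarrow> b \<in> qalg V \<Longrightarrow> a - b \<in> qalg V"
    and cscale_in_qalg: "a \<in> qalg V \<Longrightarrow> cscale c a \<in> qalg V"
  by (auto simp: qalg_def cscale_def; metis add_0 diff_0_right)+

lemma sum_in_qalg: "(\<And>p. p \<in> S \<Longrightarrow> g p \<in> qalg V) \<Longrightarrow> sum g S \<in> qalg V"
  by (induction S rule: infinite_finite_induct) (auto intro: zero_in_qalg add_in_qalg)

lemma qlinear_sum:
  assumes f: "qlinear V W f" and "finite S" and "\<And>p. p \<in> S \<Longrightarrow> g p \<in> qalg V"
  shows "f (sum g S) = (\<Sum>p\<in>S. f (g p))"
  using assms(2,3)
proof (induction S rule: finite_induct)
  case empty
  have "f (cscale 0 0) = cscale 0 (f 0)"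
    using f zero_in_qalg unfolding qlinear_def by blast
  then show ?case
    by simp
next
  case (insert p S)
  then show ?case
    using f by (simp add: qlinear_def sum_in_qalg)
qed

section \<open>The inner product of a quantum set and adjoints\<close>

text \<open>
  The blocks partition \<open>Field V\<close>, so the double sum over blocks and their indices is one sum over
  all indices, weighted by the size of the block \<open>V `` {i}\<close> of \<open>i\<close>.  Indices outside \<open>Field V\<close> get
  weight zero, since there \<open>V `` {i}\<close> is empty.
\<close>

lemma qinner_entries:
  fixes V :: "('n::finite \<times> 'n) set"
  assumes "quantum_set V"
  shows "qinner V a b = (\<Sum>i\<in>UNIV. \<Sum>k\<in>UNIV. of_nat (card (V `` {i})) * (cnj (a $ k $ i) * b $ k $ i))"
proof -
  have eq: "equiv (Field V) V"
    using assms by (simp add: quantum_set_def)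
  have disj: "\<forall>B\<in>Field V // V. \<forall>C\<in>Field V // V. B \<noteq> C \<longrightarrow> B \<inter> C = {}"
    using quotient_disj[OF eq] by blast
  have "qinner V a b
      = (\<Sum>B\<in>Field V // V. \<Sum>i\<in>B. of_nat (card (V `` {i})) * (cadj a ** b) $ i $ i)"
    unfolding qinner_def sum_distrib_left
  proof (intro sum.cong refl)
    fix B i
    assume "B \<in> Field V // V" "i \<in> B"
    then have "V `` {i} = B"
      using eq by (metis Image_singleton_iff equiv_class_eq quotientE)
    then show "of_nat (card B) * (cadj a ** b) $ i $ i
        = of_nat (card (V `` {i})) * (cadj a ** b) $ i $ i"
      by simp
  qed
  also have "\<dots> = (\<Sum>i\<in>\<Union>(Field V // V). of_nat (card (V `` {i})) * (cadj a ** b) $ i $ i)"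
    using disj by (simp add: sum.Union_disjoint)
  also have "\<dots> = (\<Sum>i\<in>UNIV. of_nat (card (V `` {i})) * (cadj a ** b) $ i $ i)"
  proof (rule sum.mono_neutral_left)
    show "\<forall>i\<in>UNIV - \<Union> (Field V // V). of_nat (card (V `` {i})) * (cadj a ** b) $ i $ i = 0"
    proof
      fix i
      assume "i \<in> UNIV - \<Union> (Field V // V)"
      then have "i \<notin> Field V"
        using Union_quotient[OF eq] by simp
      then have "V `` {i} = {}"
        by (auto simp: Field_def)
      then show "of_nat (card (V `` {i})) * (cadj a ** b) $ i $ i = 0"
        by simp
    qed
  qed auto
  also have "\<dots> = (\<Sum>i\<in>UNIV. \<Sum>k\<in>UNIV. of_nat (card (V `` {i})) * (cnj (a $ k $ i) * b $ k $ i))"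
    by (simp add: matrix_matrix_mult_def cadj_def sum_distrib_left)
  finally show ?thesis .
qed

text \<open>
  An entry of an element of the algebra can only be nonzero at indices lying in a block, where the
  weight is positive.
\<close>

lemma qinner_definite:
  assumes V: "quantum_set V" and a: "a \<in> qalg V" and "qinner V a a = 0"
  shows "a = 0"
proof -
  let ?t = "\<lambda>i k. real (card (V `` {i})) * (cmod (a $ k $ i))\<^sup>2"
  have "complex_of_real (\<Sum>i\<in>UNIV. \<Sum>k\<in>UNIV. ?t i k) = qinner V a a"
    unfolding qinner_entries[OF V] of_real_sum of_real_mult complex_norm_square
    by (simp add: mult.commute)
  then have "(\<Sum>i\<in>UNIV. \<Sum>k\<in>UNIV. ?t i k) = 0"
    unfolding assms(3) of_real_eq_0_iff .
  then have zero: "?t i k = 0" for i k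
    by (auto simp: sum_nonneg_eq_0_iff sum_nonneg)
  have "a $ k $ i = 0" for k i
  proof (rule ccontr)
    assume nz: "a $ k $ i \<noteq> 0"
    then have "(k, i) \<in> V"
      using a by (auto simp: qalg_def)
    then have "(i, i) \<in> V"
      using V unfolding quantum_set_def
      by (metis FieldI2 equiv_def refl_on_def)
    then have "card (V `` {i}) \<noteq> 0"
      by auto
    then show False
      using zero[of i k] nz by simp
  qed
  then show ?thesis
    by (simp add: vec_eq_iff)
qed

lemma qinner_add_left: "qinner V (a + b) c = qinner V a c + qinner V b c"
  by (simp add: qinner_def cadj_def matrix_matrix_mult_def sum.distrib algebra_simps)

lemma qinner_diff_right: "qinner V a (b - c) = qinner V a b - qinner V a c"
  by (simp add: qinner_def mult_diff_right sum_subtractf algebra_simps)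

lemma qinner_cscale_left: "qinner V (cscale k a) b = cnj k * qinner V a b"
  by (simp add: qinner_def cadj_def cscale_def matrix_matrix_mult_def sum_distrib_left mult_ac)

lemma qinner_sum_left: "qinner V (sum g S) b = (\<Sum>p\<in>S. qinner V (g p) b)"
proof (induction S rule: infinite_finite_induct)
  case (insert p S)
  then show ?case
    by (simp add: qinner_add_left)
qed (simp_all add: qinner_def cadj_def matrix_matrix_mult_def)

text \<open>
  The matrix units of the algebra are orthogonal, so the entries of the adjoint can be read off by
  pairing with them; definiteness of the inner product makes the result the unique solution.
\<close>

lemma qadjoint_in_qalg:
  fixes V :: "('n::finite \<times> 'n) set" and W :: "('m::finite \<times> 'm) set"
  assumes V: "quantum_set V" and f: "qlinear V W f"
  shows "qadjoint V W f b \<in> qalg V"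
proof -
  \<comment> \<open>The unit at \<open>(k, i)\<close> has squared norm \<open>card (V `` {i})\<close>, hence the denominator.\<close>
  define a :: "'n cmat" where "a = (\<chi> k i. if (k, i) \<in> V
      then qinner W (f (munit k i)) b / of_nat (card (V `` {i})) else 0)"
  have a: "a \<in> qalg V"
    by (simp add: a_def qalg_def)
  have adj: "qinner V x a = qinner W (f x) b" if x: "x \<in> qalg V" for x
  proof -
    have "qinner V x a = (\<Sum>i\<in>UNIV. \<Sum>k\<in>UNIV. if (k, i) \<in> V
        then cnj (x $ k $ i) * qinner W (f (munit k i)) b else 0)"
      unfolding qinner_entries[OF V]
    proof (intro sum.cong refl)
      fix k i
      have "card (V `` {i}) \<noteq> 0" if "(k, i) \<in> V"
      proof -
        have "(i, k) \<in> V"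
          using V that by (auto simp: quantum_set_def equiv_def dest: symD)
        then show ?thesis
          by auto
      qed
      then show "of_nat (card (V `` {i})) * (cnj (x $ k $ i) * a $ k $ i)
        = (if (k, i) \<in> V then cnj (x $ k $ i) * qinner W (f (munit k i)) b else 0)"
        by (simp add: a_def)
    qed
    also have "\<dots> = (\<Sum>k\<in>UNIV. \<Sum>i\<in>UNIV. if (k, i) \<in> V
        then cnj (x $ k $ i) * qinner W (f (munit k i)) b else 0)"
      by (rule sum.swap)
    also have "\<dots> = (\<Sum>p\<in>UNIV. if p \<in> V
        then cnj (x $ fst p $ snd p) * qinner W (f (munit (fst p) (snd p))) b else 0)"
      by (simp add: sum.cartesian_product case_prod_beta)
    also have "\<dots> = (\<Sum>p\<in>V. cnj (x $ fst p $ snd p) * qinner W (f (munit (fst p) (snd p))) b)"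
      by (simp add: sum.If_cases)
    also have "\<dots> = qinner W (\<Sum>p\<in>V. cscale (x $ fst p $ snd p) (f (munit (fst p) (snd p)))) b"
      by (simp add: qinner_sum_left qinner_cscale_left)
    also have "(\<Sum>p\<in>V. cscale (x $ fst p $ snd p) (f (munit (fst p) (snd p))))
        = f (\<Sum>p\<in>V. cscale (x $ fst p $ snd p) (munit (fst p) (snd p)))"
      using f by (subst qlinear_sum[OF f])
        (auto simp: munit_in_qalg f[unfolded qlinear_def] intro!: cscale_in_qalg)
    finally show ?thesis
      using matrix_unit_expansion[OF x] by simp
  qed
  have "qadjoint V W f b = a"
    unfolding qadjoint_def
  proof (rule the_equality)
    fix a'
    assume a': "a' \<in> qalg V \<and> (\<forall>x\<in>qalg V. qinner V x a' = qinner W (f x) b)"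
    have "a' - a \<in> qalg V"
      using a a' by (simp add: diff_in_qalg)
    then have "a' - a = 0"
      using a' adj by (intro qinner_definite[OF V]) (auto simp: qinner_diff_right)
    then show "a' = a"
      by simp
  qed (use a adj in auto)
  then show ?thesis
    using a by simp
qed

section \<open>The edge relation preserves operators on the Hilbert space\<close>

text \<open>
  A symmetric and transitive relation is reflexive on its field, which spares treating the field
  of a tensor product separately.
\<close>

lemma quantum_set_iff: "quantum_set V \<longleftrightarrow> sym V \<and> trans V"
proof
  assume V: "sym V \<and> trans V"
  have "refl_on (Field V) V"
  proof (rule refl_onI)
    fix i
    assume "i \<in> Field V"
    then obtain j where "(i, j) \<in> V \<or> (j, i) \<in> V"
      unfolding Field_def by blast
    then show "(i, i) \<in> V"
      using V by (meson symD transD)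
  qed
  moreover have "V \<subseteq> Field V \<times> Field V"
    by (auto intro: FieldI1 FieldI2)
  ultimately show "quantum_set V"
    unfolding quantum_set_def equiv_def using V by (elim conjE) (intro conjI)
next
  assume "quantum_set V"
  then show "sym V \<and> trans V"
    unfolding quantum_set_def equiv_def by (elim conjE) (intro conjI)
qed

lemma quantum_set_qtensor:
  assumes "quantum_set V" and "quantum_set W"
  shows "quantum_set (qtensor V W)"
proof -
  have "sym (qtensor V W)"
    using assms by (auto simp: quantum_set_iff sym_def qtensor_def)
  moreover have "trans (qtensor V W)"
  proof (rule transI)
    fix x y z
    assume "(x, y) \<in> qtensor V W" "(y, z) \<in> qtensor V W"
    then have "(fst x, fst z) \<in> V" "(snd x, snd z) \<in> W"
      using assms by (auto simp: quantum_set_iff qtensor_def intro: transD)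
    then show "(x, z) \<in> qtensor V W"
      by (cases x; cases z) (simp add: qtensor_def)
  qed
  ultimately show ?thesis
    by (simp add: quantum_set_iff)
qed

lemma qlinear_mult:
  assumes "quantum_set V"
  shows "qlinear (qtensor V V) V mult"
proof -
  have "mult t \<in> qalg V" if t: "t \<in> qalg (qtensor V V)" for t
    unfolding qalg_def
  proof (intro CollectI allI impI)
    fix i j
    assume "mult t $ i $ j \<noteq> 0"
    then obtain k where "t $ (i, k) $ (k, j) \<noteq> 0"
      by (auto simp: mult_def elim: sum.not_neutral_contains_not_neutral)
    then have "(i, k) \<in> V" "(k, j) \<in> V"
      using t by (auto simp: qalg_def qtensor_def)
    then show "(i, j) \<in> V"
      using assms by (auto simp: quantum_set_def equiv_def dest: transD)
  qed
  then show ?thesis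
    by (auto simp: qlinear_def mult_def cscale_def vec_eq_iff sum.distrib sum_distrib_left)
qed

lemma comult_in_qalg: "quantum_set V \<Longrightarrow> comult V a \<in> qalg (qtensor V V)"
  unfolding comult_def by (intro qadjoint_in_qalg quantum_set_qtensor qlinear_mult)

lemma tensor_in_qalg: "a \<in> qalg V \<Longrightarrow> b \<in> qalg W \<Longrightarrow> tensor a b \<in> qalg (qtensor V W)"
  by (auto simp: qalg_def qtensor_def tensor_def)

text \<open>
  The expansion in matrix units ranges over all index pairs; those outside the blocks, on which
  \<open>f\<close> and \<open>g\<close> are unconstrained, come with coefficient zero.
\<close>

lemma tensor_map_in_qalg:
  assumes t: "t \<in> qalg (qtensor V W)"
    and f: "\<And>a. a \<in> qalg V \<Longrightarrow> f a \<in> qalg V'"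
    and g: "\<And>b. b \<in> qalg W \<Longrightarrow> g b \<in> qalg W'"
  shows "tensor_map f g t \<in> qalg (qtensor V' W')"
proof -
  have "cscale (t $ (i, k) $ (j, l)) (tensor (f (munit i j)) (g (munit k l)))
      \<in> qalg (qtensor V' W')" for i j k l
  proof (cases "t $ (i, k) $ (j, l) = 0")
    case False
    then have "(i, j) \<in> V" "(k, l) \<in> W"
      using t by (auto simp: qalg_def qtensor_def)
    then show ?thesis
      by (intro cscale_in_qalg tensor_in_qalg f g munit_in_qalg)
  qed (simp add: zero_in_qalg)
  then show ?thesis
    unfolding tensor_map_def by (intro sum_in_qalg)
qed

lemma tensor_assoc_in_qalg:
  "t \<in> qalg (qtensor (qtensor U V) W) \<Longrightarrow> tensor_assoc t \<in> qalg (qtensor U (qtensor V W))"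
  by (fastforce simp: qalg_def qtensor_def tensor_assoc_def)

text \<open>
  The left leg of \<open>t\<close> supplies the column and the right leg the row of the result, so both lie in
  the field.
\<close>

lemma op_act_in_BH:
  assumes t: "t \<in> qalg (qtensor V V)"
  shows "op_act t x \<in> BH V"
  unfolding BH_def
proof (intro CollectI allI impI)
  fix k j
  assume "op_act t x $ k $ j \<noteq> 0"
  then have "(\<Sum>i\<in>UNIV. \<Sum>l\<in>UNIV. t $ (i, k) $ (j, l) * x $ l $ i) \<noteq> 0"
    by (simp add: op_act_def)
  then obtain i l where "t $ (i, k) $ (j, l) * x $ l $ i \<noteq> 0"
    by (meson sum.not_neutral_contains_not_neutral)
  then have "(i, j) \<in> V" "(k, l) \<in> V"
    using t by (auto simp: qalg_def qtensor_def)
  then show "k \<in> Field V \<and> j \<in> Field V"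
    by (simp add: FieldI1 FieldI2)
qed

lemma qone_in_qalg: "quantum_set V \<Longrightarrow> qone V \<in> qalg V"
  by (auto simp: qone_def qalg_def quantum_set_def equiv_def refl_on_def)

lemma edges_in_BH:
  assumes "quantum_graph V A"
  shows "edges V A x \<in> BH V"
proof -
  have V: "quantum_set V" and A: "\<And>a. a \<in> qalg V \<Longrightarrow> A a \<in> qalg V"
    using assms by (auto simp: quantum_graph_def qlinear_def)
  have m: "mult t \<in> qalg V" if "t \<in> qalg (qtensor V V)" for t
    using qlinear_mult[OF V] that by (simp add: qlinear_def)
  have "edge_op V A (tensor (qone V) (qone V)) \<in> qalg (qtensor V V)"
    unfolding edge_op_def
    by (intro tensor_map_in_qalg[where V = V and W = "qtensor V V"] tensor_assoc_in_qalg
        tensor_map_in_qalg[where V = "qtensor V V" and W = V]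
        tensor_map_in_qalg[where V = V and W = V] tensor_in_qalg
        qone_in_qalg comult_in_qalg V m)
      (auto simp: A intro: tensor_map_in_qalg)
  then show ?thesis
    unfolding edges_def by (rule op_act_in_BH)
qed

section \<open>Hilbert--Schmidt geometry\<close>

lemma hs_inner_entries: "hs_inner x y = (\<Sum>i\<in>UNIV. \<Sum>k\<in>UNIV. cnj (x $ k $ i) * y $ k $ i)"
  by (simp add: hs_inner_def trace_def cadj_def matrix_matrix_mult_def)

lemma hs_inner_definite:
  assumes "hs_inner x x = 0"
  shows "x = 0"
proof -
  have "complex_of_real (\<Sum>i\<in>UNIV. \<Sum>k\<in>UNIV. (cmod (x $ k $ i))\<^sup>2) = hs_inner x x"
    unfolding hs_inner_entries of_real_sum complex_norm_square
    by (simp add: mult.commute)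
  then have "(\<Sum>i\<in>UNIV. \<Sum>k\<in>UNIV. (cmod (x $ k $ i))\<^sup>2) = 0"
    unfolding assms of_real_eq_0_iff .
  then show ?thesis
    by (simp add: sum_nonneg_eq_0_iff sum_nonneg vec_eq_iff)
qed

lemma hs_inner_diff_right: "hs_inner x (y - z) = hs_inner x y - hs_inner x z"
  by (simp add: hs_inner_def mult_diff_right trace_sub)

text \<open>Compression by a self-adjoint \<open>q\<close> is self-adjoint on \<open>B(H)\<close>, by cyclicity of the trace.\<close>

lemma hs_inner_compress:
  assumes "cadj q = q"
  shows "hs_inner (q ** x ** q) y = hs_inner x (q ** y ** q)"
proof -
  have "hs_inner (q ** x ** q) y = trace (q ** (cadj x ** q ** y))"
    using assms by (simp add: hs_inner_def cadj_mult matrix_mul_assoc)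
  also have "\<dots> = hs_inner x (q ** y ** q)"
    by (subst trace_mul_sym) (simp add: hs_inner_def matrix_mul_assoc)
  finally show ?thesis .
qed

text \<open>
  Two orthogonal projections of one point differ by an element of \<open>S\<close> orthogonal to itself, so
  closure under differences already gives uniqueness.  Existence is assumed, since an explicit
  projection is at hand where the lemma is applied.
\<close>

lemma img_projector_onto:
  assumes diff: "\<And>x y. x \<in> S \<Longrightarrow> y \<in> S \<Longrightarrow> x - y \<in> S"
    and sub: "S \<subseteq> BH V"
    and ex: "\<And>x. x \<in> BH V \<Longrightarrow> \<exists>y\<in>S. \<forall>z\<in>S. hs_inner z (x - y) = 0"
  shows "img V (projector_onto S) = S"
proof -
  have proj: "projector_onto S x = y" if y: "y \<in> S" "\<forall>z\<in>S. hs_inner z (x - y) = 0" for x y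
    unfolding projector_onto_def
  proof (rule the_equality)
    fix y'
    assume y': "y' \<in> S \<and> (\<forall>z\<in>S. hs_inner z (x - y') = 0)"
    have "hs_inner z (y' - y) = 0" if "z \<in> S" for z
      using y y' that by (simp add: hs_inner_diff_right)
    then have "y' - y = 0"
      using y y' diff by (intro hs_inner_definite) auto
    then show "y' = y"
      by simp
  qed (use y in auto)
  have "projector_onto S x \<in> S" if "x \<in> BH V" for x
    using ex[OF that] proj by auto
  moreover have "projector_onto S x = x" if "x \<in> S" for x
    using that by (intro proj) (auto simp: hs_inner_entries)
  ultimately show ?thesis
    using sub unfolding img_def by (metis image_iff subsetI subset_antisym subsetD image_subsetI)
qed

section \<open>Operators on the Hilbert space and projections of projective subsets\<close>

lemma BH_add: "x \<in> BH V \<Longrightarrow> y \<in> BH V \<Longrightarrow> x + y \<in> BH V"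
  by (auto simp: BH_def; metis add_0)

lemma BH_diff: "x \<in> BH V \<Longrightarrow> y \<in> BH V \<Longrightarrow> x - y \<in> BH V"
  by (auto simp: BH_def; metis diff_0_right)

lemma BH_cscale: "x \<in> BH V \<Longrightarrow> cscale c x \<in> BH V"
  by (auto simp: BH_def cscale_def)

lemma BH_zero: "0 \<in> BH V"
  by (simp add: BH_def)

lemma BH_mult: "x \<in> BH V \<Longrightarrow> y \<in> BH V \<Longrightarrow> x ** y \<in> BH V"
  unfolding BH_def matrix_matrix_mult_def
  by (auto elim!: sum.not_neutral_contains_not_neutral)

lemma qalg_subset_BH: "qalg V \<subseteq> BH V"
  by (auto simp: qalg_def BH_def intro: FieldI1 FieldI2)

lemma qone_mult:
  assumes "x \<in> BH V"
  shows "qone V ** x = x"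
proof -
  have "(\<Sum>k\<in>UNIV. (if i = k \<and> i \<in> Field V then 1 else 0) * x $ k $ j) = x $ i $ j" for i j
  proof -
    have "(\<Sum>k\<in>UNIV. (if i = k \<and> i \<in> Field V then 1 else 0) * x $ k $ j)
        = (\<Sum>k\<in>UNIV. if k = i then x $ i $ j else 0)"
      using assms by (intro sum.cong) (auto simp: BH_def)
    then show ?thesis
      by simp
  qed
  then show ?thesis
    by (simp add: matrix_matrix_mult_def qone_def vec_eq_iff)
qed

lemma cadj_qone: "cadj (qone V) = qone V"
  by (auto simp: cadj_def qone_def vec_eq_iff)

lemma cadj_BH: "x \<in> BH V \<Longrightarrow> cadj x \<in> BH V"
  by (auto simp: BH_def cadj_def)

lemma mult_qone: "x \<in> BH V \<Longrightarrow> x ** qone V = x"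
  by (metis cadj_BH cadj_cadj cadj_mult cadj_qone qone_mult)

lemma qinner_mult_left: "qinner V (p ** a) b = qinner V a (cadj p ** b)"
  by (simp add: qinner_def cadj_mult matrix_mul_assoc)

text \<open>
  Right-linearity makes the projector left multiplication by its value \<open>p\<close> at \<open>1\<close>.  Idempotence
  then gives \<open>p p = p\<close>.  Symmetry, tested against \<open>1\<close>, says that \<open>p\<^sup>* - p\<close> is orthogonal to the
  whole algebra, hence to itself.
\<close>

lemma projection_is_projector:
  assumes V: "quantum_set V" and Y: "projective_subset V Y"
  defines "p \<equiv> projection V Y"
  shows "p \<in> qalg V" and "p ** p = p" and "cadj p = p"
proof -
  have one: "qone V \<in> qalg V"
    using V by (rule qone_in_qalg)
  have left: "Y a = p ** a" if "a \<in> qalg V" for a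
  proof -
    have "Y (qone V ** a) = p ** a"
      using Y one that by (simp add: projective_subset_def p_def projection_def)
    then show ?thesis
      using that qalg_subset_BH by (metis qone_mult subsetD)
  qed
  show p: "p \<in> qalg V"
    using Y one by (simp add: projective_subset_def qlinear_def p_def projection_def)
  show "p ** p = p"
    using Y one left[OF p] by (simp add: projective_subset_def p_def projection_def)
  have cp: "cadj p \<in> qalg V"
    using p V by (auto simp: qalg_def cadj_def quantum_set_def equiv_def dest: symD)
  have "qinner V a (cadj p - p) = 0" if a: "a \<in> qalg V" for a
  proof -
    have "qinner V (p ** a) (qone V) = qinner V a (p ** qone V)"
      using Y a one left by (simp add: projective_subset_def)
    then show ?thesis
      using p cp
      by (simp add: qinner_mult_left qinner_diff_right mult_qone subsetD[OF qalg_subset_BH])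
  qed
  then have "cadj p - p = 0"
    using p cp by (intro qinner_definite[OF V]) (auto simp: diff_in_qalg)
  then show "cadj p = p"
    by simp
qed

section \<open>Vertex covers and independent sets\<close>

theorem proposition4p44:
  fixes V :: "('n::finite \<times> 'n) set"
    and A X :: "'n cmat \<Rightarrow> 'n cmat"
  assumes "quantum_graph V A" and "undirected V A" and "loopless V A"
    and "projective_subset V X"
  shows "vertex_cover V A X \<longleftrightarrow> independent_set V A (complement V X)"
proof -
  have V: "quantum_set V"
    using assms(1) by (simp add: quantum_graph_def)
  define p where "p = projection V X"
  define q where "q = qone V - p"
  have p: "p \<in> BH V" "p ** p = p" "cadj p = p"
    using projection_is_projector[OF V assms(4)] qalg_subset_BH by (auto simp: p_def)
  have one: "qone V \<in> BH V"
    using qone_in_qalg[OF V] qalg_subset_BH by auto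
  have q: "q \<in> BH V"
    using p one by (simp add: q_def BH_diff)
  have qq: "q ** q = q" and pq: "p ** q = 0" and qp: "q ** p = 0"
    using p one by (simp_all add: q_def mult_diff_left mult_diff_right qone_mult mult_qone)
  have q_adj: "cadj q = q"
    using p(3) cadj_qone[of V] by (simp add: q_def cadj_def vec_eq_iff)
  \<comment> \<open>This will be the image of the union of the three products.\<close>
  define S where "S = {x \<in> BH V. q ** x ** q = 0}"
  have S_sub: "cmat.subspace S"
    unfolding S_def cmat.subspace_def
    by (auto simp: BH_zero BH_add BH_cscale mult_cscale_left mult_cscale_right
        matrix_add_ldistrib mult_add_left)
  have proj_S: "img V (projector_onto S) = S"
  proof (rule img_projector_onto)
    fix x
    assume x: "x \<in> BH V"
    have "q ** (q ** x ** q) ** q = q ** x ** q"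
      by (metis matrix_mul_assoc qq)
    then have "x - q ** x ** q \<in> S"
      using x q by (simp add: S_def BH_diff BH_mult mult_diff_left mult_diff_right)
    moreover have "hs_inner z (x - (x - q ** x ** q)) = 0" if "z \<in> S" for z
      using that hs_inner_compress[OF q_adj, of z x] by (simp add: S_def hs_inner_entries)
    ultimately show "\<exists>y\<in>S. \<forall>z\<in>S. hs_inner z (x - y) = 0"
      by blast
  qed (use S_sub in \<open>auto simp: cmat.subspace_diff\<close>, simp add: S_def)
  have whole: "projection V whole = qone V"
    by (simp add: projection_def whole_def)
  have X1: "img V (pcross V X whole) = {x ** p |x. x \<in> BH V}"
    unfolding img_def pcross_def whole p_def[symmetric] by (force simp: qone_mult image_iff)
  have X2: "img V (pcross V whole X) = {p ** x |x. x \<in> BH V}"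
    unfolding img_def pcross_def whole p_def[symmetric]
    using p by (force simp: mult_qone image_iff BH_mult)
  have corner_zero: "q ** (x ** p) ** q = 0" "q ** (p ** x) ** q = 0" for x
    by (metis matrix_mul_assoc times0_left times0_right pq qp)+
  have X3: "img V (pcross V X X) \<subseteq> S"
    unfolding img_def pcross_def p_def[symmetric] S_def
    using p by (auto simp: BH_mult corner_zero)
  have "cmat.span (img V (pcross V X whole) \<union> img V (pcross V whole X)) = S"
  proof
    show "cmat.span (img V (pcross V X whole) \<union> img V (pcross V whole X)) \<subseteq> S"
      using p unfolding X1 X2
      by (intro cmat.span_minimal S_sub) (auto simp: S_def BH_mult corner_zero)
  next
    show "S \<subseteq> cmat.span (img V (pcross V X whole) \<union> img V (pcross V whole X))"
    proof
      fix x
      assume "x \<in> S"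
      then have x: "x \<in> BH V" and "q ** x ** q = 0"
        by (auto simp: S_def)
      \<comment> \<open>With \<open>qxq = 0\<close> the remaining corners are \<open>xp\<close> and \<open>pxq = p (x - xp)\<close>.\<close>
      then have "x = x ** p + p ** (x - x ** p)"
        using p x by (simp add: q_def mult_diff_left mult_diff_right qone_mult mult_qone
            BH_mult matrix_mul_assoc algebra_simps)
      moreover have "x - x ** p \<in> BH V"
        using x p by (simp add: BH_diff BH_mult)
      ultimately show "x \<in> cmat.span (img V (pcross V X whole) \<union> img V (pcross V whole X))"
        unfolding X1 X2 using x by (metis (mono_tags, lifting) UnI1 UnI2 cmat.span_add cmat.span_base mem_Collect_eq)
    qed
  qed
  then have U1: "img V (punion V (pcross V X whole) (pcross V whole X)) = S"
    by (simp add: punion_def proj_S)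
  \<comment> \<open>The third product is already contained in the union of the first two.\<close>
  have "cmat.span (S \<union> img V (pcross V X X)) = S"
    using X3 S_sub by (simp add: Un_absorb2 cmat.span_eq_iff)
  then have cover: "img V (punion V (punion V (pcross V X whole) (pcross V whole X)) (pcross V X X)) = S"
    unfolding punion_def[of V "punion V (pcross V X whole) (pcross V whole X)"] U1
    by (simp add: proj_S)
  have compl: "projection V (complement V X) = q"
    using q by (simp add: projection_def[of V "complement V X"] complement_def p_def[symmetric]
        q_def[symmetric] mult_qone)
  have "vertex_cover V A X \<longleftrightarrow> (\<forall>e\<in>img V (edges V A). q ** e ** q = 0)"
    unfolding vertex_cover_def psub_def cover
    using edges_in_BH[OF assms(1)] by (auto simp: S_def img_def)
  also have "\<dots> \<longleftrightarrow> (\<forall>e\<in>img V (edges V A). \<forall>x\<in>BH V. hs_inner (q ** x ** q) e = 0)"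
  proof (intro ball_cong refl iffI ballI)
    fix e
    assume "e \<in> img V (edges V A)" and h: "\<forall>x\<in>BH V. hs_inner (q ** x ** q) e = 0"
    \<comment> \<open>Testing with \<open>x = qeq\<close> and moving the compression across gives the squared norm of \<open>qeq\<close>.\<close>
    then have "q ** e ** q \<in> BH V"
      using q edges_in_BH[OF assms(1)] by (auto simp: img_def BH_mult)
    then have "hs_inner (q ** e ** q) (q ** e ** q) = 0"
      using h by (metis hs_inner_compress[OF q_adj])
    then show "q ** e ** q = 0"
      by (rule hs_inner_definite)
  next
    fix e x
    assume "q ** e ** q = 0"
    then show "hs_inner (q ** x ** q) e = 0"
      unfolding hs_inner_compress[OF q_adj] by (simp add: hs_inner_entries)
  qed
  also have "\<dots> \<longleftrightarrow> independent_set V A (complement V X)"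
    unfolding independent_set_def pdisjoint_def
    by (auto simp: img_def pcross_def compl)
  finally show ?thesis .
qed

end
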